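(* Let $\beta>1$ and let $D$ be a nonnegative integer valued random variable such that $\mathbb{P}(D\ge n)\sim L(n)\,n^{1-\beta}$ as $n\to\infty$ for some slowly varying function $L$. For $p\in(0,1)$ let $S_D$ denote the $p$-thinning of $D$. Then for every integer $k\ge\beta$, $$\lim_{p\to 0+}\frac{\mathbb{P}(S_D=k)}{\mathbb{P}(S_D=k-1)}=\frac{k-\beta}{k}.$$
   Context: For a nonnegative integer valued random variable $D$ and $p\in(0,1)$, the $p$-thinning of $D$ is $S_D=\sum_{i=1}^{D}X_i$, where $X_1,X_2,\dots$ are i.i.d. Bernoulli($p$) random variables independent of $D$ (the dependence of $S_D$ on $p$ is suppressed in the notation). A positive measurable function $L$ is slowly varying (at infinity) if $L(tx)/L(x)\to1$ as $x\to\infty$ for every $t>0$. *)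

theory Defs
  imports "HOL-Probability.Probability" "HOL-Library.Landau_Symbols"
begin

text \<open>
  Only the behaviour near infinity matters, so \<open>L\<close> need only be positive and measurable
  on some half-line \<open>[a, \<infinity>)\<close>; its values elsewhere are unconstrained.
\<close>

definition slowly_varying :: "(real \<Rightarrow> real) \<Rightarrow> bool" where
  "slowly_varying L \<longleftrightarrow>
     (\<exists>a. (\<forall>x\<ge>a. 0 < L x) \<and> set_borel_measurable borel {a..} L) \<and>
     (\<forall>t>0. ((\<lambda>x. L (t * x) / L x) \<longlongrightarrow> 1) at_top)"

text \<open>
  \<open>S\<close> is a \<open>p\<close>-thinning of \<open>D\<close>. The trials are \<open>X 1, X 2, \<dots>\<close>; slot \<open>0\<close> of the family is
  overwritten by \<open>D\<close>, so that the first condition is the mutual independence of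
  \<open>D, X 1, X 2, \<dots>\<close>, i.e. the trials are independent and \<open>D\<close> is independent of the whole
  sequence of trials.
\<close>

definition is_thinning ::
    "'a measure \<Rightarrow> real \<Rightarrow> ('a \<Rightarrow> nat) \<Rightarrow> ('a \<Rightarrow> nat) \<Rightarrow> bool" where
  "is_thinning M p D S \<longleftrightarrow>
     (\<exists>X :: nat \<Rightarrow> 'a \<Rightarrow> nat.
        prob_space.indep_vars M (\<lambda>_. count_space UNIV) (X(0 := D)) UNIV \<and>
        (\<forall>i\<ge>1. distr M (count_space UNIV) (X i) =
                 measure_pmf (map_pmf of_bool (bernoulli_pmf p))) \<and>
        (\<forall>\<omega>\<in>space M. S \<omega> = (\<Sum>i=1..D \<omega>. X i \<omega>)))"

end

theory Submission imports Defs begin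

text \<open>
  Write \<open>\<gamma> = \<beta> - 1\<close>, \<open>G y = P(D > y)\<close>, and \<open>b(j, n, p)\<close> for the probability of \<open>j\<close> successes in
  \<open>n\<close> trials. Conditionally on \<open>D\<close> the thinning is binomial, so \<open>P(S = j)\<close> is the expectation of
  \<open>b(j, D, p)\<close> (\<open>thinning_pmf\<close>). Only the tail of \<open>D\<close> is known to be regular, not its point
  probabilities, so one sums by parts: \<open>P(S > j)\<close> is the sum of \<open>p b(j, n, p) P(D > n)\<close> over
  \<open>n\<close>, and with \<open>p = 1 / y\<close> this is the integral of \<open>G (x y) b(j, floor (x y), 1 / y)\<close> over
  \<open>x > 0\<close> (\<open>expectation_neg_binom_cdf\<close>).

  After division by \<open>G y\<close> the integrand tends to \<open>x powr (j - \<gamma>) exp (- x) / j!\<close> as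
  \<open>y \<rightarrow> \<infinity>\<close>, by regular variation of \<open>G\<close> (\<open>tail_fun_regularly_varying\<close>) and the Poisson limit
  (\<open>binom_wt_Poisson_limit\<close>). A Potter bound for \<open>G\<close> (\<open>tail_fun_Potter_bound\<close>) justifies dominated
  convergence, and for \<open>\<gamma> < j + 1\<close> this gives \<open>P(S > j) / G y \<rightarrow> \<Gamma>(j + 1 - \<gamma>) / j!\<close>
  (\<open>neg_binom_cdf_asymptotics\<close>). Both properties of \<open>G\<close> come from
  slow variation of \<open>L\<close> and monotonicity of \<open>G\<close>: the first by sandwiching between multiples of
  integers, the second by doubling.

  Taking differences, \<open>P(S = j + 1) / G y \<rightarrow> \<gamma> \<Gamma>(j + 1 - \<gamma>) / (j + 1)!\<close>. For \<open>k > \<beta>\<close> the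
  quotient of these limits for \<open>j = k - 1\<close> and \<open>j = k - 2\<close> is \<open>(k - \<beta>) / k\<close>. For \<open>k = \<beta>\<close> the
  limit integral for \<open>j = k - 2\<close> diverges, so the denominator grows faster than \<open>G y\<close> while the
  numerator does not, and the ratio tends to \<open>0\<close>.
\<close>

section \<open>Regular variation of a monotone tail\<close>

text \<open>
For \<open>T n = P(D \<ge> n)\<close> and \<open>y \<ge> 0\<close> this is \<open>P(D > y)\<close>. The strict inequality makes the value at \<open>y\<close> equal
to \<open>T (n + 1)\<close> with \<open>n\<close> the integer part of \<open>y\<close>, which is the coefficient that summation by
parts puts in front of the \<open>n\<close>-th binomial weight.
\<close>

definition tail_fun :: "(nat \<Rightarrow> real) \<Rightarrow> real \<Rightarrow> real" where
  "tail_fun T y = T (Suc (nat \<lfloor>y\<rfloor>))"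

text \<open>
Slow variation controls \<open>L (t x) / L x\<close> for a fixed \<open>t\<close> only. Along the multiples \<open>a m\<close> and
\<open>d m\<close> the ratio of the arguments is exactly \<open>a / d\<close>, so that a single \<open>t\<close> suffices.
\<close>

lemma tail_ratio_integers:
  fixes T :: "nat \<Rightarrow> real" and a d :: nat
  assumes L: "slowly_varying L"
    and T: "T \<sim>[at_top] (\<lambda>n. L (real n) * real n powr (- \<gamma>))"
    and ad: "a > 0" "d > 0"
  shows "(\<lambda>m. T (a * m) / T (d * m)) \<longlonglongrightarrow> (real a / real d) powr (- \<gamma>)"
proof -
  have top: "filterlim (\<lambda>m. c * m) at_top sequentially" if "c > 0" for c :: nat
    by (rule filterlim_subseq) (use that in \<open>auto simp: strict_mono_def\<close>)
  have lim: "filterlim (\<lambda>m. real (d * m)) at_top sequentially"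
    by (rule filterlim_compose[OF filterlim_real_sequentially top]) (use ad in auto)
  have eq: "(\<lambda>m. T (c * m)) \<sim>[sequentially] (\<lambda>m. L (real (c * m)) * real (c * m) powr (- \<gamma>))"
    if "c > 0" for c :: nat
    using asymp_equiv_compose'[OF T top[OF that]] .
  have "((\<lambda>x. L (real a / real d * x) / L x) \<longlongrightarrow> 1) at_top"
    using L ad unfolding slowly_varying_def by (meson divide_pos_pos of_nat_0_less_iff)
  from filterlim_compose[OF this lim]
  have "(\<lambda>m. L (real (a * m)) / L (real (d * m)) * (real a / real d) powr (- \<gamma>))
      \<longlonglongrightarrow> 1 * (real a / real d) powr (- \<gamma>)"
    using ad by (intro tendsto_mult tendsto_const) simp
  moreover have "\<forall>\<^sub>F m in sequentially.
      L (real (a * m)) / L (real (d * m)) * (real a / real d) powr (- \<gamma>) =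
      (L (real (a * m)) * real (a * m) powr (- \<gamma>)) / (L (real (d * m)) * real (d * m) powr (- \<gamma>))"
    using eventually_gt_at_top[of 0]
    by eventually_elim (use ad in \<open>simp add: powr_divide powr_mult\<close>)
  ultimately have "(\<lambda>m. (L (real (a * m)) * real (a * m) powr (- \<gamma>)) /
      (L (real (d * m)) * real (d * m) powr (- \<gamma>))) \<longlonglongrightarrow> (real a / real d) powr (- \<gamma>)"
    by (simp add: filterlim_cong)
  then show ?thesis
    using tendsto_asymp_equiv_cong[OF asymp_equiv_divide[OF eq[OF ad(1)] eq[OF ad(2)]]]
    by simp
qed

lemma regularly_varying_tail_pos:
  fixes T :: "nat \<Rightarrow> real"
  assumes L: "slowly_varying L"
    and T: "T \<sim>[at_top] (\<lambda>n. L (real n) * real n powr (- \<gamma>))"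
    and mono: "decseq T"
  shows "T n > 0"
proof -
  obtain a where a: "\<And>x. x \<ge> a \<Longrightarrow> 0 < L x"
    using L by (auto simp: slowly_varying_def)
  have "\<forall>\<^sub>F m in sequentially. L (real m) * real m powr (- \<gamma>) > 0"
    using eventually_gt_at_top[of 0] eventually_ge_at_top[of "nat \<lceil>a\<rceil>"]
    by eventually_elim (use a in \<open>simp add: nat_ceiling_le_eq\<close>)
  moreover have "\<forall>\<^sub>F m in sequentially. T m > 0 \<longleftrightarrow> L (real m) * real m powr (- \<gamma>) > 0"
    using asymp_equiv_eventually_pos_iff[OF T] .
  ultimately have "\<forall>\<^sub>F m in sequentially. T m > 0 \<and> m \<ge> n"
    using eventually_ge_at_top[of n] by eventually_elim auto
  then obtain m where "T m > 0" "m \<ge> n"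
    using eventually_happens'[OF sequentially_bot] by blast
  then show ?thesis
    using decseqD[OF mono, of n m] by linarith
qed

lemma tail_fun_antimono: "decseq T \<Longrightarrow> x \<le> y \<Longrightarrow> tail_fun T y \<le> tail_fun T x"
  unfolding tail_fun_def by (rule decseqD) (auto intro!: nat_mono floor_mono)

text \<open>
Monotonicity carries the limit from rational to real scaling factors. For a rational \<open>a / d < s\<close> and the
least integer \<open>m\<close> with \<open>d m > y\<close>, eventually \<open>a m \<le> s y\<close>, hence the ratio at \<open>y\<close> is at most
\<open>T (a m) / T (d m)\<close>, which tends to \<open>(a / d) powr (- \<gamma>)\<close>; and \<open>a / d\<close> can be taken
arbitrarily close to \<open>s\<close>.
\<close>

lemma tail_fun_limsup:
  fixes T :: "nat \<Rightarrow> real"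
  assumes L: "slowly_varying L"
    and T: "T \<sim>[at_top] (\<lambda>n. L (real n) * real n powr (- \<gamma>))"
    and mono: "decseq T"
    and s: "s > 0" and c: "c > s powr (- \<gamma>)"
  shows "\<forall>\<^sub>F y in at_top. tail_fun T (s * y) / tail_fun T y < c"
proof -
  have pos: "T n > 0" for n
    by (rule regularly_varying_tail_pos[OF L T mono])
  have "((\<lambda>r. r powr (- \<gamma>)) \<longlongrightarrow> s powr (- \<gamma>)) (at_left s)"
    by (rule tendsto_intros) (use s in auto)
  then have "\<forall>\<^sub>F r in at_left s. r powr (- \<gamma>) < c"
    using c order_tendstoD(2) by blast
  moreover have "\<forall>\<^sub>F r in at_left s. r > 0"
    using s by (intro eventually_at_leftI[of 0]) auto
  ultimately obtain r where r: "r < s" "\<And>q. r < q \<Longrightarrow> q < s \<Longrightarrow> q > 0 \<and> q powr (- \<gamma>) < c"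
    using eventually_conj[of "\<lambda>r. r powr (- \<gamma>) < c" "at_left s" "\<lambda>r. r > 0"]
    unfolding eventually_at_left[OF s] by auto
  obtain q :: rat where q: "r < of_rat q" "of_rat q < s"
    using of_rat_dense[OF r(1)] by blast
  obtain u v where uv: "q = Fract u v" "v > 0"
    by (cases q) auto
  have "u > 0"
    using r(2)[OF q] uv by (simp add: of_rat_rat zero_less_divide_iff)
  \<comment> \<open>\<open>r\<close> may be negative; positivity of \<open>q\<close> comes from the choice of the left neighbourhood of \<open>s\<close>.\<close>
  define a d where "a = nat u" and "d = nat v"
  have ad: "a > 0" "d > 0" and q': "of_rat q = real a / real d"
    using \<open>u > 0\<close> uv by (auto simp: a_def d_def of_rat_rat)
  have less: "real a / real d < s" "(real a / real d) powr (- \<gamma>) < c"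
    using r(2)[OF q] q unfolding q' by auto
  have m_top: "filterlim (\<lambda>y::real. Suc (nat \<lfloor>y / real d\<rfloor>)) at_top at_top"
  proof -
    have "filterlim (\<lambda>y. y / real d) at_top at_top"
      using ad filterlim_tendsto_pos_mult_at_top[OF tendsto_const[of "1 / real d"] _ filterlim_ident]
      by simp
    then have "filterlim (\<lambda>y::real. nat \<lfloor>y / real d\<rfloor>) at_top at_top"
      by (intro filterlim_compose[OF filterlim_nat_sequentially]
          filterlim_compose[OF filterlim_floor_sequentially])
    then show ?thesis
      by (rule filterlim_compose[OF filterlim_Suc])
  qed
  have "\<forall>\<^sub>F y in at_top. T (a * Suc (nat \<lfloor>y / real d\<rfloor>)) / T (d * Suc (nat \<lfloor>y / real d\<rfloor>)) < c"
    using filterlim_compose[OF tail_ratio_integers[OF L T ad] m_top] less(2)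
    by (rule order_tendstoD(2))
  moreover have "\<forall>\<^sub>F y in at_top. y \<ge> max 0 (real a / (s - real a / real d))"
    by (rule eventually_ge_at_top)
  ultimately show ?thesis
  proof eventually_elim
    case (elim y)
    let ?m = "Suc (nat \<lfloor>y / real d\<rfloor>)"
    have y: "y \<ge> 0" "real a / (s - real a / real d) \<le> y"
      using elim(2) by (simp_all only: max.bounded_iff)
    then have y': "real a \<le> (s - real a / real d) * y"
      using less(1) by (simp add: pos_divide_le_eq mult.commute)
    have m: "real ?m \<le> y / real d + 1" "y / real d < real ?m"
      using y(1) ad by (auto; linarith)+
    have "real (a * ?m) \<le> s * y"
    proof -
      have "real (a * ?m) \<le> real a * (y / real d + 1)"
        unfolding of_nat_mult using m(1) by (intro mult_left_mono) auto
      then show ?thesis using y' by (simp add: algebra_simps)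
    qed
    then have "a * ?m \<le> Suc (nat \<lfloor>s * y\<rfloor>)"
      by linarith
    moreover have "y < real (d * ?m)"
      using m(2) ad by (simp add: field_simps)
    then have "Suc (nat \<lfloor>y\<rfloor>) \<le> d * ?m"
      using y(1) ad by linarith
    ultimately have "tail_fun T (s * y) \<le> T (a * ?m)" "T (d * ?m) \<le> tail_fun T y"
      unfolding tail_fun_def using mono by (auto simp: decseq_def)
    then have "tail_fun T (s * y) / tail_fun T y \<le> T (a * ?m) / T (d * ?m)"
      using pos by (intro frac_le) (auto intro: less_imp_le)
    then show ?case using elim(1) by linarith
  qed
qed

text \<open>
The lower bound is the upper bound for the scaling factor \<open>1 / s\<close>, applied at \<open>s y\<close>.
\<close>

lemma tail_fun_regularly_varying:
  fixes T :: "nat \<Rightarrow> real"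
  assumes L: "slowly_varying L"
    and T: "T \<sim>[at_top] (\<lambda>n. L (real n) * real n powr (- \<gamma>))"
    and mono: "decseq T"
    and s: "s > 0"
  shows "((\<lambda>y. tail_fun T (s * y) / tail_fun T y) \<longlongrightarrow> s powr (- \<gamma>)) at_top"
proof (rule order_tendstoI)
  fix c assume c: "c > s powr (- \<gamma>)"
  then show "\<forall>\<^sub>F y in at_top. tail_fun T (s * y) / tail_fun T y < c"
    by (rule tail_fun_limsup[OF L T mono s])
next
  fix c assume c: "c < s powr (- \<gamma>)"
  have pos: "tail_fun T y > 0" for y
    unfolding tail_fun_def by (rule regularly_varying_tail_pos[OF L T mono])
  show "\<forall>\<^sub>F y in at_top. c < tail_fun T (s * y) / tail_fun T y"
  proof (cases "c \<le> 0")
    case True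
    then show ?thesis
      using pos by (intro always_eventually allI) (meson le_less_trans divide_pos_pos)
  next
    case False
    have "(1 / s) powr (- \<gamma>) = 1 / s powr (- \<gamma>)"
      using s by (simp add: powr_divide)
    also have "\<dots> < 1 / c"
      using c False s by (intro divide_strict_left_mono) auto
    finally have "\<forall>\<^sub>F y in at_top. tail_fun T (1 / s * y) / tail_fun T y < 1 / c"
      using s by (intro tail_fun_limsup[OF L T mono]) auto
    moreover have "filterlim (\<lambda>y. s * y) at_top at_top"
      using s by (intro filterlim_tendsto_pos_mult_at_top[OF tendsto_const]) (auto intro: filterlim_ident)
    ultimately have "\<forall>\<^sub>F y in at_top. tail_fun T (1 / s * (s * y)) / tail_fun T (s * y) < 1 / c"
      by (rule eventually_compose_filterlim)
    then show ?thesis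
      by eventually_elim (use s False pos in \<open>simp add: field_simps\<close>)
  qed
qed

text \<open>
A Potter bound, obtained by doubling: for large \<open>z\<close> the step from \<open>z\<close> to \<open>2 z\<close> costs at most a
factor \<open>2 powr \<alpha>\<close>, since \<open>\<alpha> > \<gamma>\<close>, and about \<open>log 2 (y / z)\<close> steps lead from \<open>z\<close> past \<open>y\<close>.
Below the threshold from which doubling works, the tail is bounded by its value at \<open>0\<close>, and this
loss is absorbed into the constant.
\<close>

lemma tail_fun_Potter_bound:
  fixes T :: "nat \<Rightarrow> real"
  assumes L: "slowly_varying L"
    and T: "T \<sim>[at_top] (\<lambda>n. L (real n) * real n powr (- \<gamma>))"
    and mono: "decseq T"
    and \<gamma>: "\<gamma> > 0" and \<alpha>: "\<alpha> > \<gamma>"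
  obtains C where "C > 0"
    "\<forall>\<^sub>F y in at_top. \<forall>x\<in>{0<..1}. tail_fun T (x * y) / tail_fun T y \<le> C * x powr (- \<alpha>)"
proof -
  let ?G = "tail_fun T"
  have pos: "?G y > 0" for y
    unfolding tail_fun_def by (rule regularly_varying_tail_pos[OF L T mono])
  have anti: "?G y \<le> ?G x" if "x \<le> y" for x y
    by (rule tail_fun_antimono[OF mono that])
  have "2 powr (- \<alpha>) < 2 powr (- \<gamma>)"
    using \<alpha> by simp
  from order_tendstoD(1)[OF tail_fun_regularly_varying[OF L T mono, of 2] this]
  obtain y1 where y1: "\<And>y. y \<ge> y1 \<Longrightarrow> 2 powr (- \<alpha>) < ?G (2 * y) / ?G y"
    by (auto simp: eventually_at_top_linorder)
  define y0 where "y0 = max 1 y1"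
  have y0: "y0 > 0" by (simp add: y0_def)
  have double: "?G y \<le> 2 powr \<alpha> * ?G (2 * y)" if "y \<ge> y0" for y
    using y1[of y] that pos[of y] by (simp add: y0_def powr_minus field_simps)
  have iter: "?G z \<le> 2 powr (\<alpha> * real i) * ?G (2 ^ i * z)" if "z \<ge> y0" for z i
  proof (induction i)
    case (Suc i)
    have "1 * z \<le> 2 ^ i * z"
      using that y0 by (intro mult_right_mono) auto
    then have "?G (2 ^ i * z) \<le> 2 powr \<alpha> * ?G (2 * (2 ^ i * z))"
      using that by (intro double) auto
    then have "2 powr (\<alpha> * real i) * ?G (2 ^ i * z)
      \<le> 2 powr (\<alpha> * real i) * (2 powr \<alpha> * ?G (2 * (2 ^ i * z)))"
      by (intro mult_left_mono) auto
    also have "\<dots> = 2 powr (\<alpha> * real (Suc i)) * ?G (2 ^ Suc i * z)"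
      by (simp add: powr_add distrib_left mult_ac)
    finally show ?case
      using Suc by linarith
  qed auto
  have above: "?G z \<le> 2 powr \<alpha> * (y / z) powr \<alpha> * ?G y" if "z \<ge> y0" "z \<le> y" for y z
  proof -
    define i where "i = nat \<lceil>log 2 (y / z)\<rceil>"
    have z: "z > 0" "1 \<le> y / z" using that y0 by auto
    have l: "log 2 (y / z) \<ge> 0" using z by simp
    have i: "log 2 (y / z) \<le> real i" "real i \<le> 1 + log 2 (y / z)"
      using l unfolding i_def by linarith+
    have "y / z = 2 powr (log 2 (y / z))" using z by simp
    also have "\<dots> \<le> 2 powr (real i)" using i by simp
    finally have "y \<le> 2 ^ i * z" using z by (simp add: powr_realpow field_simps)
    have "\<alpha> * real i \<le> \<alpha> * (1 + log 2 (y / z))"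
      using i \<alpha> \<gamma> by (intro mult_left_mono) auto
    then have "2 powr (\<alpha> * real i) \<le> 2 powr (\<alpha> * (1 + log 2 (y / z)))"
      by simp
    also have "\<dots> = 2 powr \<alpha> * (2 powr (log 2 (y / z))) powr \<alpha>"
      by (simp only: powr_powr powr_add[symmetric] algebra_simps mult_1_right mult_1_left)
    also have "\<dots> = 2 powr \<alpha> * (y / z) powr \<alpha>" using z by simp
    finally have "2 powr (\<alpha> * real i) * ?G (2 ^ i * z) \<le> 2 powr \<alpha> * (y / z) powr \<alpha> * ?G y"
      using anti[OF \<open>y \<le> 2 ^ i * z\<close>] pos by (intro mult_mono) (auto intro: less_imp_le)
    with iter[OF that(1), of i] show ?thesis by linarith
  qed
  define C where "C = 2 powr \<alpha> * (?G 0 / ?G y0)"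
  have ge1: "?G 0 / ?G y0 \<ge> 1"
    using anti[of 0 y0] y0 pos[of y0] by simp
  have C: "C > 0" "2 powr \<alpha> \<le> C"
    unfolding C_def using pos mult_left_mono[OF ge1, of "2 powr \<alpha>"]
    by (auto intro!: mult_pos_pos divide_pos_pos)
  show thesis
  proof (rule that[OF C(1)])
    show "\<forall>\<^sub>F y in at_top. \<forall>x\<in>{0<..1}. ?G (x * y) / ?G y \<le> C * x powr (- \<alpha>)"
      using eventually_ge_at_top[of y0]
    proof eventually_elim
      case (elim y)
      show ?case
      proof
        fix x :: real assume x: "x \<in> {0<..1}"
        have y: "y > 0" using elim y0 by linarith
        have "?G (x * y) \<le> C * x powr (- \<alpha>) * ?G y"
        proof (cases "x * y \<ge> y0")
          case True
          have "?G (x * y) \<le> 2 powr \<alpha> * (y / (x * y)) powr \<alpha> * ?G y"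
            using True x y by (intro above) auto
          also have "(y / (x * y)) powr \<alpha> = x powr (- \<alpha>)"
            using x y by (simp add: powr_divide powr_minus field_simps)
          also have "2 powr \<alpha> * x powr (- \<alpha>) * ?G y \<le> C * x powr (- \<alpha>) * ?G y"
            using C pos[of y] by (intro mult_right_mono) auto
          finally show ?thesis .
        next
          case False
          have "?G (x * y) \<le> ?G 0"
            using x y by (intro anti) auto
          also have "\<dots> = ?G 0 / ?G y0 * ?G y0"
            using pos[of y0] by simp
          also have "\<dots> \<le> ?G 0 / ?G y0 * (2 powr \<alpha> * (y / y0) powr \<alpha> * ?G y)"
            using above[OF order.refl elim] pos by (intro mult_left_mono) (auto intro: less_imp_le divide_nonneg_nonneg)
          also have "\<dots> = C * (y / y0) powr \<alpha> * ?G y"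
            by (simp add: C_def)
          also have "\<dots> \<le> C * (1 / x) powr \<alpha> * ?G y"
          proof -
            have "y / y0 \<le> 1 / x" using False x y0 by (simp add: field_simps)
            then show ?thesis using C pos[of y] y y0 \<alpha> \<gamma>
              by (intro mult_right_mono mult_left_mono powr_mono2) auto
          qed
          finally show ?thesis using x by (simp add: powr_divide powr_minus field_simps)
        qed
        then show "?G (x * y) / ?G y \<le> C * x powr (- \<alpha>)"
          using pos[of y] by (simp add: pos_divide_le_eq)
      qed
    qed
  qed
qed

section \<open>Scaling limit of tails weighted by binomial probabilities\<close>

definition binom_wt :: "nat \<Rightarrow> nat \<Rightarrow> real \<Rightarrow> real" where
  "binom_wt j n p = real (n choose j) * p ^ j * (1 - p) ^ (n - j)"

lemma binom_wt_nonneg: "0 \<le> p \<Longrightarrow> p \<le> 1 \<Longrightarrow> 0 \<le> binom_wt j n p"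
  by (simp add: binom_wt_def)

text \<open>
The law of small numbers with \<open>p = 1 / y\<close> and about \<open>x y\<close> trials. The power of \<open>1 - p\<close> is
rewritten as \<open>((1 - 1 / y) powr y) powr ((n - j) / y)\<close>, whose base and exponent both converge.
\<close>

lemma binom_wt_Poisson_limit:
  assumes x: "x > 0"
  shows "((\<lambda>y. binom_wt j (nat \<lfloor>x * y\<rfloor>) (1 / y)) \<longlongrightarrow> x ^ j * exp (- x) / fact j) at_top"
proof -
  define n where "n y = nat \<lfloor>x * y\<rfloor>" for y :: real
  have shifted: "((\<lambda>y. (real (n y) - real i) / y) \<longlongrightarrow> x) at_top" for i
  proof (rule tendsto_sandwich)
    have inv: "((\<lambda>y::real. c / y) \<longlongrightarrow> 0) at_top" for c
      by (rule tendsto_divide_0[OF tendsto_const filterlim_at_top_imp_at_infinity[OF filterlim_ident]])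
    show "((\<lambda>y. x - (1 + real i) / y) \<longlongrightarrow> x) at_top"
      using tendsto_diff[OF tendsto_const inv, of x "1 + real i"] by simp
    show "((\<lambda>y. x - real i / y) \<longlongrightarrow> x) at_top"
      using tendsto_diff[OF tendsto_const inv, of x "real i"] by simp
    show "\<forall>\<^sub>F y in at_top. x - (1 + real i) / y \<le> (real (n y) - real i) / y"
      using eventually_gt_at_top[of 0]
    proof eventually_elim
      case (elim y)
      have "x * y - 1 \<le> real (n y)" unfolding n_def by linarith
      then have "(x * y - 1 - real i) / y \<le> (real (n y) - real i) / y"
        using elim by (intro divide_right_mono) auto
      then show ?case using elim by (simp add: diff_divide_distrib add_divide_distrib)
    qed
    show "\<forall>\<^sub>F y in at_top. (real (n y) - real i) / y \<le> x - real i / y"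
      using eventually_gt_at_top[of 0]
    proof eventually_elim
      case (elim y)
      have "x * y \<ge> 0" using elim x by simp
      then have "real (n y) \<le> x * y" unfolding n_def by linarith
      then show ?case using elim by (simp add: field_simps)
    qed
  qed
  have "((\<lambda>y. (\<Prod>i<j. (real (n y) - real i) / y) / fact j *
      ((1 + (- 1) / y) powr y) powr ((real (n y) - real j) / y))
      \<longlongrightarrow> (\<Prod>i<j. x) / fact j * exp (- 1) powr x) at_top"
    by (intro tendsto_intros shifted tendsto_exp_limit_at_top) auto
  also have "(\<Prod>i<j. x) / fact j * exp (- 1) powr x = x ^ j * exp (- x) / fact j"
    by (simp add: powr_def)
  finally have lim: "((\<lambda>y. (\<Prod>i<j. (real (n y) - real i) / y) / fact j *
      ((1 + (- 1) / y) powr y) powr ((real (n y) - real j) / y))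
      \<longlongrightarrow> x ^ j * exp (- x) / fact j) at_top" .
  have "\<forall>\<^sub>F y in at_top. (\<Prod>i<j. (real (n y) - real i) / y) / fact j *
      ((1 + (- 1) / y) powr y) powr ((real (n y) - real j) / y) = binom_wt j (n y) (1 / y)"
    using eventually_gt_at_top[of 1] eventually_ge_at_top[of "real (Suc j) / x"]
  proof eventually_elim
    case (elim y)
    have "real (Suc j) \<le> x * y" using elim x by (simp add: pos_divide_le_eq mult.commute)
    then have nj: "j \<le> n y" unfolding n_def by linarith
    have "real (n y choose j) = (\<Prod>i<j. real (n y) - real i) / fact j"
      by (simp add: binomial_gbinomial gbinomial_prod_rev lessThan_atLeast0)
    then have "(\<Prod>i<j. (real (n y) - real i) / y) / fact j = real (n y choose j) * (1 / y) ^ j"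
      by (simp add: prod_dividef power_one_over)
    moreover have "((1 + (- 1) / y) powr y) powr ((real (n y) - real j) / y) = (1 - 1 / y) ^ (n y - j)"
      using elim nj by (simp add: powr_powr powr_realpow of_nat_diff[symmetric] del: of_nat_diff)
    ultimately show ?case by (simp add: binom_wt_def)
  qed
  with lim show ?thesis unfolding n_def by (simp add: filterlim_cong)
qed

text \<open>
The weight inherits the shape of its Poisson limit uniformly in \<open>y\<close>; the constant
\<open>exp (j + 1)\<close> pays for the \<open>j\<close> missing factors \<open>1 - p\<close> and for the rounding of \<open>x y\<close>.
\<close>

lemma binom_wt_le:
  assumes x: "x > 0" and y: "y \<ge> 1"
  shows "binom_wt j (nat \<lfloor>x * y\<rfloor>) (1 / y) \<le> exp (real (Suc j)) * (x ^ j * exp (- x))"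
proof (cases "j \<le> nat \<lfloor>x * y\<rfloor>")
  case True
  define n where "n = nat \<lfloor>x * y\<rfloor>"
  have xy: "x * y \<ge> 0" using x y by simp
  have n: "x * y - 1 \<le> real n" "real n \<le> x * y" "j \<le> n"
    using xy True unfolding n_def by linarith+
  have "real (n choose j) * (1 / y) ^ j \<le> real (n ^ j) * (1 / y) ^ j"
    using n(3) y by (intro mult_right_mono) (simp_all add: binomial_le_pow del: of_nat_power)
  also have "\<dots> = (real n / y) ^ j" by (simp add: power_divide)
  also have "\<dots> \<le> x ^ j"
    using n y by (intro power_mono) (simp_all add: pos_divide_le_eq)
  finally have 1: "real (n choose j) * (1 / y) ^ j \<le> x ^ j" .
  have "(1 - 1 / y) ^ (n - j) \<le> exp (- 1 / y) ^ (n - j)"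
    using y exp_ge_add_one_self[of "- 1 / y"] by (intro power_mono) auto
  also have "\<dots> = exp (- ((real n - real j) / y))"
    using n(3) by (simp add: exp_of_nat_mult[symmetric] of_nat_diff diff_divide_distrib)
  also have "\<dots> \<le> exp (real (Suc j) - x)"
  proof -
    have "x - real (Suc j) \<le> x - real (Suc j) / y"
      using divide_left_mono[of 1 y "real (Suc j)"] y by simp
    also have "\<dots> = (x * y - real (Suc j)) / y"
      using y by (simp add: diff_divide_distrib)
    also have "\<dots> \<le> (real n - real j) / y"
      using y n by (intro divide_right_mono) auto
    finally show ?thesis by simp
  qed
  finally have 2: "(1 - 1 / y) ^ (n - j) \<le> exp (real (Suc j)) * exp (- x)"
    by (simp add: exp_diff exp_minus field_simps)
  have "binom_wt j n (1 / y) \<le> x ^ j * (exp (real (Suc j)) * exp (- x))"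
    unfolding binom_wt_def using 1 2 x y by (intro mult_mono) auto
  then show ?thesis by (simp add: n_def mult_ac)
next
  case False
  then show ?thesis using x by (simp add: binom_wt_def binomial_eq_0)
qed

lemma Gamma_density_integral:
  fixes a :: real
  assumes "a > 0"
  shows "set_integrable lborel {0<..} (\<lambda>x. x powr (a - 1) * exp (- x))"
    and "(LINT x:{0<..}|lborel. x powr (a - 1) * exp (- x)) = Gamma a"
proof -
  have "has_bochner_integral lborel (\<lambda>x. indicator {0<..} x *\<^sub>R (x powr (a - 1) * exp (- x))) (Gamma a)"
  proof (rule has_bochner_integral_nn_integral)
    have "(\<integral>\<^sup>+ x. ennreal (indicator {0<..} x *\<^sub>R (x powr (a - 1) * exp (- x))) \<partial>lborel) =
        (\<integral>\<^sup>+ x. ennreal (indicator {0..} x * x powr (a - 1) / exp x) \<partial>lborel)"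
      by (intro nn_integral_cong) (auto simp: indicator_def exp_minus field_simps)
    also have "\<dots> = ennreal (Gamma a)"
      by (rule Gamma_conv_nn_integral_real[OF assms, symmetric])
    finally show "(\<integral>\<^sup>+ x. ennreal (indicator {0<..} x *\<^sub>R (x powr (a - 1) * exp (- x))) \<partial>lborel)
      = ennreal (Gamma a)" .
    show "0 \<le> Gamma a" using Gamma_real_pos[OF assms] by simp
  qed auto
  then show "set_integrable lborel {0<..} (\<lambda>x. x powr (a - 1) * exp (- x))"
    and "(LINT x:{0<..}|lborel. x powr (a - 1) * exp (- x)) = Gamma a"
    unfolding set_integrable_def set_lebesgue_integral_def
    by (auto simp: has_bochner_integral_iff)
qed

lemma tail_fun_measurable [measurable]: "tail_fun T \<in> borel_measurable borel"
  unfolding tail_fun_def by measurable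

lemma binom_wt_floor_measurable [measurable (raw)]:
  assumes [measurable]: "f \<in> borel_measurable M"
  shows "(\<lambda>x. binom_wt j (nat \<lfloor>f x :: real\<rfloor>) p) \<in> borel_measurable M"
  by (rule measurable_compose[of "\<lambda>x. nat \<lfloor>f x\<rfloor>" M "count_space UNIV"]) auto

text \<open>
Dominated convergence: regular variation and the Poisson limit give the pointwise limit. The
majorant comes from the Potter bound for \<open>x \<le> 1\<close>, and from monotonicity of the tail for \<open>x > 1\<close>,
where the ratio of the tails is at most \<open>1\<close>. The set \<open>A\<close> is a parameter because the limit integral
over the whole half-line diverges at \<open>0\<close> in the critical case, in which only sets bounded away
from \<open>0\<close> can be used.
\<close>

lemma tail_binom_integral_limit:
  fixes T :: "nat \<Rightarrow> real" and j :: nat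
  assumes L: "slowly_varying L"
    and T: "T \<sim>[at_top] (\<lambda>n. L (real n) * real n powr (- \<gamma>))"
    and mono: "decseq T" and \<gamma>: "\<gamma> > 0" and \<alpha>: "\<alpha> > \<gamma>"
    and A: "A \<in> sets borel" "A \<subseteq> {0<..}"
    and int: "set_integrable lborel A (\<lambda>x. x powr (real j - \<alpha>) * exp (- x))"
  shows "((\<lambda>y. LINT x:A|lborel. tail_fun T (x * y) / tail_fun T y * binom_wt j (nat \<lfloor>x * y\<rfloor>) (1 / y))
      \<longlongrightarrow> (LINT x:A|lborel. x powr (real j - \<gamma>) * exp (- x) / fact j)) at_top"
proof -
  note [measurable] = A(1)
  have pos: "tail_fun T y > 0" for y
    unfolding tail_fun_def by (rule regularly_varying_tail_pos[OF L T mono])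
  obtain C where C: "C > 0"
    "\<forall>\<^sub>F y in at_top. \<forall>x\<in>{0<..1}. tail_fun T (x * y) / tail_fun T y \<le> C * x powr (- \<alpha>)"
    using tail_fun_Potter_bound[OF L T mono \<gamma> \<alpha>] .
  define w where "w x = C * exp (real (Suc j)) * (indicator A x * (x powr (real j - \<alpha>) * exp (- x)))
    + exp (real (Suc j)) * (indicator A x * (x ^ j * exp (- x)))" for x
  have "set_integrable lborel {0<..} (\<lambda>x. x powr (real (Suc j) - 1) * exp (- x))"
    by (rule Gamma_density_integral) auto
  then have "set_integrable lborel A (\<lambda>x. x powr (real (Suc j) - 1) * exp (- x))"
    by (rule set_integrable_subset) (use A in auto)
  then have int': "integrable lborel (\<lambda>x. indicator A x * (x ^ j * exp (- x)))"
    unfolding set_integrable_def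
    by (rule Bochner_Integration.integrable_cong[THEN iffD1, rotated -1])
       (use A in \<open>auto simp: indicator_def powr_realpow\<close>)
  have w: "integrable lborel w"
    unfolding w_def using int int' unfolding set_integrable_def
    by (intro Bochner_Integration.integrable_add integrable_mult_right) auto
  show ?thesis
    unfolding set_lebesgue_integral_def
  proof (rule integral_dominated_convergence_at_top[OF _ _ w])
    show "AE x in lborel. ((\<lambda>y. indicator A x *\<^sub>R (tail_fun T (x * y) / tail_fun T y *
        binom_wt j (nat \<lfloor>x * y\<rfloor>) (1 / y))) \<longlongrightarrow>
        indicator A x *\<^sub>R (x powr (real j - \<gamma>) * exp (- x) / fact j)) at_top"
    proof (rule AE_I2)
      fix x :: real
      show "((\<lambda>y. indicator A x *\<^sub>R (tail_fun T (x * y) / tail_fun T y *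
        binom_wt j (nat \<lfloor>x * y\<rfloor>) (1 / y))) \<longlongrightarrow>
        indicator A x *\<^sub>R (x powr (real j - \<gamma>) * exp (- x) / fact j)) at_top"
      proof (cases "x \<in> A")
        case True
        then have x: "x > 0" using A by auto
        have eq: "x powr (- \<gamma>) * (x ^ j * exp (- x) / fact j) = x powr (real j - \<gamma>) * exp (- x) / fact j"
          using x by (simp add: powr_diff powr_minus powr_realpow field_simps)
        have "((\<lambda>y. tail_fun T (x * y) / tail_fun T y * binom_wt j (nat \<lfloor>x * y\<rfloor>) (1 / y))
            \<longlongrightarrow> x powr (real j - \<gamma>) * exp (- x) / fact j) at_top"
          using tendsto_mult[OF tail_fun_regularly_varying[OF L T mono x] binom_wt_Poisson_limit[OF x, of j]]
          unfolding eq .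
        then show ?thesis using True by simp
      qed simp
    qed
    show "\<forall>\<^sub>F y in at_top. AE x in lborel. norm (indicator A x *\<^sub>R (tail_fun T (x * y) / tail_fun T y *
        binom_wt j (nat \<lfloor>x * y\<rfloor>) (1 / y))) \<le> w x"
      using C(2) eventually_ge_at_top[of 1]
    proof eventually_elim
      case (elim y)
      have "norm (indicator A x *\<^sub>R (tail_fun T (x * y) / tail_fun T y *
        binom_wt j (nat \<lfloor>x * y\<rfloor>) (1 / y))) \<le> w x" for x
      proof (cases "x \<in> A")
        case True
        then have x: "x > 0" using A by auto
        let ?r = "tail_fun T (x * y) / tail_fun T y"
        have "?r \<le> C * x powr (- \<alpha>) + 1"
        proof (cases "x \<le> 1")
          case True
          then have "?r \<le> C * x powr (- \<alpha>)" using elim(1) x by simp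
          then show ?thesis by simp
        next
          case False
          then have "y \<le> x * y" using elim(2) by simp
          then have "?r \<le> 1" using tail_fun_antimono[OF mono] pos by simp
          then show ?thesis using C(1) by (simp add: add_increasing)
        qed
        moreover have "?r \<ge> 0" using pos by (simp add: less_imp_le)
        moreover have "binom_wt j (nat \<lfloor>x * y\<rfloor>) (1 / y) \<ge> 0"
          using elim(2) by (intro binom_wt_nonneg) auto
        ultimately have "norm (?r * binom_wt j (nat \<lfloor>x * y\<rfloor>) (1 / y)) \<le>
          (C * x powr (- \<alpha>) + 1) * (exp (real (Suc j)) * (x ^ j * exp (- x)))"
          unfolding real_norm_def abs_mult using binom_wt_le[OF x elim(2), of j]
          by (intro mult_mono) (auto simp: abs_of_nonneg)
        also have "\<dots> = w x"
          using True x by (simp add: w_def powr_diff powr_minus powr_realpow field_simps)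
        finally show ?thesis using True by simp
      qed (simp add: w_def)
      then show ?case by simp
    qed
    show "(\<lambda>x. indicator A x *\<^sub>R (x powr (real j - \<gamma>) * exp (- x) / fact j)) \<in> borel_measurable lborel"
      by measurable
    show "(\<lambda>x. indicator A x *\<^sub>R (tail_fun T (x * y) / tail_fun T y *
        binom_wt j (nat \<lfloor>x * y\<rfloor>) (1 / y))) \<in> borel_measurable lborel" for y
      by measurable
  qed
qed

section \<open>Binomial weights as differences of negative binomial probabilities\<close>

lemma binom_wt_Suc_Suc:
  "binom_wt (Suc j) (Suc n) p = (1 - p) * binom_wt (Suc j) n p + p * binom_wt j n p"
proof (cases "j < n")
  case True
  then obtain k where "n = Suc (j + k)" using less_imp_Suc_add by blast
  then show ?thesis by (simp add: binom_wt_def algebra_simps)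
next
  case False
  then show ?thesis by (auto simp: binom_wt_def binomial_eq_0 not_less)
qed

lemma binom_wt_0_Suc: "binom_wt 0 (Suc n) p = (1 - p) * binom_wt 0 n p"
  by (simp add: binom_wt_def)

text \<open>
The probability that the \<open>(j + 1)\<close>-st success in a sequence of Bernoulli trials occurs within the
first \<open>n\<close> trials (the sum runs over the number \<open>i\<close> of trials preceding that success). At \<open>n = D\<close>
it is the conditional probability, given \<open>D\<close>, that the thinning exceeds \<open>j\<close>.
\<close>

definition neg_binom_cdf :: "nat \<Rightarrow> nat \<Rightarrow> real \<Rightarrow> real" where
  "neg_binom_cdf j n p = (\<Sum>i<n. p * binom_wt j i p)"

lemma binom_wt_eq_cdf_diff: "binom_wt (Suc j) n p = neg_binom_cdf j n p - neg_binom_cdf (Suc j) n p"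
proof (induction n)
  case 0
  then show ?case by (simp add: binom_wt_def neg_binom_cdf_def)
next
  case (Suc n)
  have "neg_binom_cdf i (Suc n) p = neg_binom_cdf i n p + p * binom_wt i n p" for i
    by (simp add: neg_binom_cdf_def)
  with Suc show ?case by (simp add: binom_wt_Suc_Suc algebra_simps)
qed

lemma neg_binom_cdf_bounds:
  assumes "0 \<le> p" "p \<le> 1"
  shows "0 \<le> neg_binom_cdf j n p" "neg_binom_cdf j n p \<le> 1"
proof -
  show "0 \<le> neg_binom_cdf j n p"
    unfolding neg_binom_cdf_def using assms by (intro sum_nonneg mult_nonneg_nonneg binom_wt_nonneg)
  have "neg_binom_cdf 0 n p = 1 - (1 - p) ^ n"
    by (induction n) (simp_all add: neg_binom_cdf_def binom_wt_def algebra_simps)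
  then have 0: "neg_binom_cdf 0 n p \<le> 1" using assms by simp
  have "neg_binom_cdf (Suc i) n p \<le> neg_binom_cdf i n p" for i
    using binom_wt_eq_cdf_diff[of i n p] binom_wt_nonneg[OF assms, of "Suc i" n] by linarith
  then show "neg_binom_cdf j n p \<le> 1"
    by (induction j) (use 0 order_trans in blast)+
qed

lemma suminf_single_index:
  fixes f :: "nat \<Rightarrow> ennreal"
  shows "(\<Sum>n. f n * indicator {a} n) = f a"
  by (subst suminf_finite[of "{a}"]) (auto simp: indicator_def)

section \<open>Thinnings\<close>

context prob_space
begin

lemma bernoulli_trial_probs:
  assumes p: "0 \<le> p" "p \<le> 1" and rv: "X \<in> measurable M (count_space UNIV)"
    and dist: "distr M (count_space UNIV) X = measure_pmf (map_pmf (of_bool :: bool \<Rightarrow> nat) (bernoulli_pmf p))"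
  shows "prob {\<omega> \<in> space M. X \<omega> = 0} = 1 - p" "prob {\<omega> \<in> space M. X \<omega> = 1} = p"
    "AE \<omega> in M. X \<omega> = 0 \<or> X \<omega> = 1"
proof -
  have *: "prob {\<omega> \<in> space M. X \<omega> \<in> B} = measure_pmf.prob (bernoulli_pmf p) (of_bool -` B)" for B
  proof -
    have "prob {\<omega> \<in> space M. X \<omega> \<in> B} = measure (distr M (count_space UNIV) X) B"
      using rv by (subst measure_distr) (auto intro!: arg_cong[where f = prob])
    then show ?thesis by (simp add: dist)
  qed
  have "(of_bool -` {0 :: nat}) = {False}" "(of_bool -` {1 :: nat}) = {True}"
     "(of_bool -` {0, 1 :: nat}) = UNIV"
    by (auto simp: of_bool_def split: if_splits)
  with *[of "{0}"] *[of "{1}"] *[of "{0, 1}"] p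
  have "prob {\<omega> \<in> space M. X \<omega> = 0} = 1 - p" "prob {\<omega> \<in> space M. X \<omega> = 1} = p"
    and 1: "prob {\<omega> \<in> space M. X \<omega> = 0 \<or> X \<omega> = 1} = 1"
    by (simp_all add: measure_pmf_single)
  then show "prob {\<omega> \<in> space M. X \<omega> = 0} = 1 - p" "prob {\<omega> \<in> space M. X \<omega> = 1} = p"
    by auto
  show "AE \<omega> in M. X \<omega> = 0 \<or> X \<omega> = 1"
    using 1 by (rule AE_prob_1[THEN AE_mp]) simp
qed

text \<open>
Only the first \<open>n\<close> trials are summed, for a number \<open>n\<close> that is independent of the value \<open>m\<close> of
\<open>D\<close>. This decoupling allows induction on \<open>n\<close>: the next trial is independent of \<open>D\<close> together with
the earlier trials, and conditioning on its outcome is Pascal's recursion for the weights.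
\<close>

lemma partial_thinning_prob:
  fixes X :: "nat \<Rightarrow> 'a \<Rightarrow> nat" and D :: "'a \<Rightarrow> nat"
  assumes p: "0 \<le> p" "p \<le> 1"
    and ind: "indep_vars (\<lambda>_. count_space UNIV) (X(0 := D)) UNIV"
    and dist: "\<And>i. i \<ge> 1 \<Longrightarrow> distr M (count_space UNIV) (X i) =
                 measure_pmf (map_pmf of_bool (bernoulli_pmf p))"
  shows "prob {\<omega> \<in> space M. D \<omega> = m \<and> (\<Sum>i=1..n. X i \<omega>) = j} =
    prob {\<omega> \<in> space M. D \<omega> = m} * binom_wt j n p"
proof (induction n arbitrary: j)
  case 0
  then show ?case by (cases j) (auto simp: binom_wt_def)
next
  case (Suc n)
  let ?E = "\<lambda>l \<omega>. D \<omega> = m \<and> (\<Sum>i=1..n. X i \<omega>) = l"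
  have rv: "(X(0 := D)) i \<in> measurable M (count_space UNIV)" for i
    using ind by (auto simp: indep_vars_def)
  have D [measurable]: "D \<in> measurable M (count_space UNIV)"
    using rv[of 0] by simp
  have X [measurable]: "X i \<in> measurable M (count_space UNIV)" if "i \<ge> 1" for i
    using rv[of i] that by simp
  have XS [measurable]: "X (Suc n) \<in> measurable M (count_space UNIV)"
    by (rule X) simp
  have sum [measurable]: "(\<lambda>\<omega>. \<Sum>i=1..n. X i \<omega>) \<in> measurable M (count_space UNIV)"
    by (intro measurable_sum_nat X) auto
  have trial: "prob {\<omega> \<in> space M. X (Suc n) \<omega> = 0} = 1 - p" "prob {\<omega> \<in> space M. X (Suc n) \<omega> = 1} = p"
    "AE \<omega> in M. X (Suc n) \<omega> = 0 \<or> X (Suc n) \<omega> = 1"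
    using bernoulli_trial_probs[OF p XS dist] by auto
  have split: "prob {\<omega> \<in> space M. ?E l \<omega> \<and> X (Suc n) \<omega> = i} =
    prob {\<omega> \<in> space M. ?E l \<omega>} * prob {\<omega> \<in> space M. X (Suc n) \<omega> = i}" for l i
  proof -
    let ?f = "\<lambda>h :: nat \<Rightarrow> nat. h 0 = m \<and> (\<Sum>i=1..n. h i) = l"
    have "indep_var (count_space UNIV) (?f \<circ> (\<lambda>\<omega>. restrict (\<lambda>i. (X(0 := D)) i \<omega>) {0..n}))
        (count_space UNIV) ((\<lambda>h. h (Suc n) = i) \<circ> (\<lambda>\<omega>. restrict (\<lambda>i. (X(0 := D)) i \<omega>) {Suc n}))"
      by (rule indep_var_compose[OF indep_var_restrict[OF ind]]) measurable
    also have "?f \<circ> (\<lambda>\<omega>. restrict (\<lambda>i. (X(0 := D)) i \<omega>) {0..n}) = ?E l"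
      by (auto simp: fun_eq_iff)
    also have "(\<lambda>h. h (Suc n) = i) \<circ> (\<lambda>\<omega>. restrict (\<lambda>i. (X(0 := D)) i \<omega>) {Suc n}) = (\<lambda>\<omega>. X (Suc n) \<omega> = i)"
      by (auto simp: fun_eq_iff)
    finally have "indep_var (count_space UNIV) (?E l) (count_space UNIV) (\<lambda>\<omega>. X (Suc n) \<omega> = i)" .
    from indep_varD[OF this, of "{True}" "{True}"] show ?thesis
      by (simp add: vimage_def Int_def conj_ac)
  qed
  show ?case
  proof (cases j)
    case 0
    have "prob {\<omega> \<in> space M. ?E 0 \<omega> \<and> X (Suc n) \<omega> = 0} = prob {\<omega> \<in> space M. ?E 0 \<omega>} * (1 - p)"
      by (simp only: split trial)
    also have "{\<omega> \<in> space M. ?E 0 \<omega> \<and> X (Suc n) \<omega> = 0} =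
       {\<omega> \<in> space M. D \<omega> = m \<and> (\<Sum>i=1..Suc n. X i \<omega>) = j}"
      by (auto simp: 0)
    finally show ?thesis
      by (simp only: Suc.IH 0 binom_wt_0_Suc) (simp add: mult_ac)
  next
    case j: (Suc l)
    have "prob {\<omega> \<in> space M. D \<omega> = m \<and> (\<Sum>i=1..Suc n. X i \<omega>) = j} =
      prob ({\<omega> \<in> space M. ?E (Suc l) \<omega> \<and> X (Suc n) \<omega> = 0} \<union> {\<omega> \<in> space M. ?E l \<omega> \<and> X (Suc n) \<omega> = 1})"
      using trial(3) by (intro finite_measure_eq_AE) (auto simp: j)
    also have "\<dots> = prob {\<omega> \<in> space M. ?E (Suc l) \<omega> \<and> X (Suc n) \<omega> = 0} +
      prob {\<omega> \<in> space M. ?E l \<omega> \<and> X (Suc n) \<omega> = 1}"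
      by (intro finite_measure_Union) auto
    also have "\<dots> = prob {\<omega> \<in> space M. D \<omega> = m} * binom_wt j (Suc n) p"
      by (simp only: split trial Suc.IH j binom_wt_Suc_Suc) (simp add: algebra_simps)
    finally show ?thesis .
  qed
qed

lemma thinning_pmf:
  assumes p: "0 \<le> p" "p \<le> 1" and D [measurable]: "D \<in> measurable M (count_space UNIV)"
    and S: "is_thinning M p D S"
  shows "prob {\<omega> \<in> space M. S \<omega> = j} = expectation (\<lambda>\<omega>. binom_wt j (D \<omega>) p)"
proof -
  obtain X :: "nat \<Rightarrow> 'a \<Rightarrow> nat" where
    ind: "indep_vars (\<lambda>_. count_space UNIV) (X(0 := D)) UNIV" and
    dist: "\<And>i. i \<ge> 1 \<Longrightarrow> distr M (count_space UNIV) (X i) = measure_pmf (map_pmf of_bool (bernoulli_pmf p))" and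
    SX: "\<And>\<omega>. \<omega> \<in> space M \<Longrightarrow> S \<omega> = (\<Sum>i=1..D \<omega>. X i \<omega>)"
    using S unfolding is_thinning_def by auto
  have rv: "(X(0 := D)) i \<in> measurable M (count_space UNIV)" for i
    using ind by (auto simp: indep_vars_def)
  have X [measurable]: "X i \<in> measurable M (count_space UNIV)" if "i \<ge> 1" for i
    using rv[of i] that by simp
  have sum [measurable]: "(\<lambda>\<omega>. \<Sum>i=1..n. X i \<omega>) \<in> measurable M (count_space UNIV)" for n
    by (intro measurable_sum_nat X) auto
  let ?A = "\<lambda>m. {\<omega> \<in> space M. D \<omega> = m \<and> (\<Sum>i=1..m. X i \<omega>) = j}"
  have "{\<omega> \<in> space M. S \<omega> = j} = (\<Union>m. ?A m)"
    using SX by auto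
  then have "emeasure M {\<omega> \<in> space M. S \<omega> = j} = (\<Sum>m. emeasure M (?A m))"
    by (simp only:) (rule suminf_emeasure[symmetric], auto simp: disjoint_family_on_def)
  also have "\<dots> = (\<Sum>m. ennreal (binom_wt j m p) * emeasure M {\<omega> \<in> space M. D \<omega> = m})"
    using partial_thinning_prob[OF p ind dist, where j = j] binom_wt_nonneg[OF p, of j]
    by (simp add: emeasure_eq_measure ennreal_mult[symmetric] mult.commute)
  also have "\<dots> = (\<Sum>m. \<integral>\<^sup>+ \<omega>. ennreal (binom_wt j m p) * indicator {D \<omega>} m \<partial>M)"
  proof (intro suminf_cong)
    fix m
    have "(\<integral>\<^sup>+ \<omega>. ennreal (binom_wt j m p) * indicator {\<omega> \<in> space M. D \<omega> = m} \<omega> \<partial>M) =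
       ennreal (binom_wt j m p) * emeasure M {\<omega> \<in> space M. D \<omega> = m}"
      by (rule nn_integral_cmult_indicator) simp
    then show "ennreal (binom_wt j m p) * emeasure M {\<omega> \<in> space M. D \<omega> = m} =
      (\<integral>\<^sup>+ \<omega>. ennreal (binom_wt j m p) * indicator {D \<omega>} m \<partial>M)"
      by (subst (asm) nn_integral_cong[of M _ "\<lambda>\<omega>. ennreal (binom_wt j m p) * indicator {D \<omega>} m"])
         (auto simp: indicator_def)
  qed
  also have "\<dots> = (\<integral>\<^sup>+ \<omega>. (\<Sum>m. ennreal (binom_wt j m p) * indicator {D \<omega>} m) \<partial>M)"
    by (rule nn_integral_suminf[symmetric]) (simp add: indicator_def)
  also have "\<dots> = (\<integral>\<^sup>+ \<omega>. ennreal (binom_wt j (D \<omega>) p) \<partial>M)"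
    by (simp only: suminf_single_index)
  finally show ?thesis
    using binom_wt_nonneg[OF p, of j] by (subst integral_eq_nn_integral) (auto simp: measure_def)
qed

text \<open>
Summation by parts, \<open>E (\<Sum>i<D. h i) = \<Sum>n. h n P(D > n)\<close>, with the series written as the
integral of a step function.
\<close>

lemma nn_integral_tail_floor:
  fixes D :: "'a \<Rightarrow> nat" and h :: "nat \<Rightarrow> real"
  assumes D [measurable]: "D \<in> measurable M (count_space UNIV)" and h: "\<And>n. h n \<ge> 0"
  shows "(\<integral>\<^sup>+ u. ennreal (indicator {0<..} u * (tail_fun (\<lambda>n. prob {\<omega> \<in> space M. n \<le> D \<omega>}) u * h (nat \<lfloor>u\<rfloor>))) \<partial>lborel)
    = (\<integral>\<^sup>+ \<omega>. ennreal (\<Sum>i<D \<omega>. h i) \<partial>M)"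
proof -
  let ?T = "\<lambda>n. prob {\<omega> \<in> space M. n \<le> D \<omega>}"
  have "(\<integral>\<^sup>+ u. ennreal (indicator {0<..} u * (tail_fun ?T u * h (nat \<lfloor>u\<rfloor>))) \<partial>lborel) =
    (\<integral>\<^sup>+ u. (\<Sum>n. ennreal (?T (Suc n) * h n) * indicator {real n..<real n + 1} u) \<partial>lborel)"
  proof (rule nn_integral_cong_AE)
    show "AE u in lborel. ennreal (indicator {0<..} u * (tail_fun ?T u * h (nat \<lfloor>u\<rfloor>))) =
      (\<Sum>n. ennreal (?T (Suc n) * h n) * indicator {real n..<real n + 1} u)"
      using AE_lborel_singleton[of "0 :: real"]
    proof eventually_elim
      case (elim u)
      show ?case
      proof (cases "u > 0")
        case True
        have "(indicator {real n..<real n + 1} u :: ennreal) = indicator {nat \<lfloor>u\<rfloor>} n" for n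
          using True by (auto simp: indicator_def split: if_splits; linarith)
        then show ?thesis using True by (simp add: suminf_single_index tail_fun_def)
      next
        case False
        with elim have "(indicator {real n..<real n + 1} u :: ennreal) = 0" for n
          by (simp add: indicator_def)
        then show ?thesis using False by simp
      qed
    qed
  qed
  also have "\<dots> = (\<Sum>n. \<integral>\<^sup>+ u. ennreal (?T (Suc n) * h n) * indicator {real n..<real n + 1} u \<partial>lborel)"
    by (rule nn_integral_suminf) simp
  also have "\<dots> = (\<Sum>n. ennreal (h n) * emeasure M {\<omega> \<in> space M. Suc n \<le> D \<omega>})"
    using h by (subst nn_integral_cmult_indicator)
      (simp_all add: emeasure_eq_measure ennreal_mult mult.commute)
  also have "\<dots> = (\<Sum>n. \<integral>\<^sup>+ \<omega>. ennreal (h n) * indicator {\<omega> \<in> space M. Suc n \<le> D \<omega>} \<omega> \<partial>M)"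
    by (intro suminf_cong nn_integral_cmult_indicator[symmetric]) simp
  also have "\<dots> = (\<integral>\<^sup>+ \<omega>. (\<Sum>n. ennreal (h n) * indicator {\<omega> \<in> space M. Suc n \<le> D \<omega>} \<omega>) \<partial>M)"
    by (rule nn_integral_suminf[symmetric]) simp
  also have "\<dots> = (\<integral>\<^sup>+ \<omega>. ennreal (\<Sum>i<D \<omega>. h i) \<partial>M)"
  proof (rule nn_integral_cong)
    fix \<omega> assume "\<omega> \<in> space M"
    then have "(\<Sum>n. ennreal (h n) * indicator {\<omega> \<in> space M. Suc n \<le> D \<omega>} \<omega>) =
      (\<Sum>n<D \<omega>. ennreal (h n))"
      by (subst suminf_finite[of "{..<D \<omega>}"]) (auto simp: indicator_def)
    then show "(\<Sum>n. ennreal (h n) * indicator {\<omega> \<in> space M. Suc n \<le> D \<omega>} \<omega>) = ennreal (\<Sum>i<D \<omega>. h i)"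
      using h by (simp add: sum_ennreal)
  qed
  finally show ?thesis .
qed

text \<open>
The substitution \<open>u = x y\<close> absorbs the factor \<open>p = 1 / y\<close> of the distribution function, so that
the integrand is in the scaling in which it converges.
\<close>

lemma expectation_neg_binom_cdf:
  fixes D :: "'a \<Rightarrow> nat" and j :: nat and y :: real
  assumes D [measurable]: "D \<in> measurable M (count_space UNIV)" and y: "y \<ge> 1"
  defines "f \<equiv> \<lambda>x. tail_fun (\<lambda>n. prob {\<omega> \<in> space M. n \<le> D \<omega>}) (x * y) * binom_wt j (nat \<lfloor>x * y\<rfloor>) (1 / y)"
  shows "set_integrable lborel {0<..} f"
    and "expectation (\<lambda>\<omega>. neg_binom_cdf j (D \<omega>) (1 / y)) = (LINT x:{0<..}|lborel. f x)"
proof -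
  let ?T = "\<lambda>n. prob {\<omega> \<in> space M. n \<le> D \<omega>}"
  have p: "0 \<le> 1 / y" "1 / y \<le> 1" using y by auto
  have f0: "f x \<ge> 0" for x
    unfolding f_def tail_fun_def using binom_wt_nonneg[OF p] by simp
  have [measurable]: "f \<in> borel_measurable borel"
    unfolding f_def by measurable
  let ?g = "\<lambda>u. ennreal (indicator {0<..} u * (tail_fun ?T u * (1 / y * binom_wt j (nat \<lfloor>u\<rfloor>) (1 / y))))"
  have "(\<integral>\<^sup>+ x. ennreal (indicator {0<..} x * f x) \<partial>lborel) = (\<integral>\<^sup>+ x. ennreal \<bar>y\<bar> * ?g (0 + y * x) \<partial>lborel)"
    using y by (intro nn_integral_cong)
      (auto simp: f_def indicator_def ennreal_mult'[symmetric] zero_less_mult_iff mult_ac)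
  also have "\<dots> = (\<integral>\<^sup>+ u. ?g u \<partial>lborel)"
    using y by (subst nn_integral_real_affine[of ?g y 0]) (auto simp: nn_integral_cmult)
  also have "\<dots> = (\<integral>\<^sup>+ \<omega>. ennreal (neg_binom_cdf j (D \<omega>) (1 / y)) \<partial>M)"
    unfolding neg_binom_cdf_def
    by (rule nn_integral_tail_floor[OF D]) (use p binom_wt_nonneg[OF p] in auto)
  finally have eq: "(\<integral>\<^sup>+ x. ennreal (indicator {0<..} x * f x) \<partial>lborel) =
    (\<integral>\<^sup>+ \<omega>. ennreal (neg_binom_cdf j (D \<omega>) (1 / y)) \<partial>M)" .
  have "(\<integral>\<^sup>+ \<omega>. ennreal (neg_binom_cdf j (D \<omega>) (1 / y)) \<partial>M) \<le> (\<integral>\<^sup>+ \<omega>. 1 \<partial>M)"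
    using neg_binom_cdf_bounds(2)[OF p] by (intro nn_integral_mono) simp
  then have "(\<integral>\<^sup>+ x. ennreal (indicator {0<..} x * f x) \<partial>lborel) < \<infinity>"
    unfolding eq by (simp add: emeasure_space_1 le_less_trans)
  then show "set_integrable lborel {0<..} f"
    unfolding set_integrable_def using f0 by (intro integrableI_nonneg) auto
  show "expectation (\<lambda>\<omega>. neg_binom_cdf j (D \<omega>) (1 / y)) = (LINT x:{0<..}|lborel. f x)"
    unfolding set_lebesgue_integral_def
    using f0 neg_binom_cdf_bounds(1)[OF p]
    by (subst (1 2) integral_eq_nn_integral) (auto simp: eq)
qed

text \<open>
The threshold \<open>\<gamma> < j + 1\<close> is integrability of \<open>x powr (j - \<gamma>)\<close> at \<open>0\<close>. At equality the limit
integrand is \<open>exp (- x) / x\<close> up to a constant; its integral over \<open>{e..1}\<close> is at least a multiple of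
\<open>- ln e\<close>, and integrals over \<open>{e..1}\<close> are lower bounds, the integrand being nonnegative.
\<close>

lemma neg_binom_cdf_asymptotics:
  fixes D :: "'a \<Rightarrow> nat" and j :: nat
  defines "T \<equiv> (\<lambda>n. prob {\<omega> \<in> space M. n \<le> D \<omega>})"
  defines "E \<equiv> (\<lambda>y. expectation (\<lambda>\<omega>. neg_binom_cdf j (D \<omega>) (1 / y)))"
  assumes D: "D \<in> measurable M (count_space UNIV)"
    and L: "slowly_varying L"
    and T: "T \<sim>[at_top] (\<lambda>n. L (real n) * real n powr (- \<gamma>))"
    and \<gamma>: "\<gamma> > 0"
  shows "\<gamma> < real j + 1 \<Longrightarrow>
      ((\<lambda>y. E y / tail_fun T y) \<longlongrightarrow> Gamma (real j + 1 - \<gamma>) / fact j) at_top"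
    and "\<gamma> = real j + 1 \<Longrightarrow> filterlim (\<lambda>y. E y / tail_fun T y) at_top at_top"
proof -
  have mono: "decseq T"
    unfolding T_def using D by (intro antimonoI finite_measure_mono) auto
  have pos: "tail_fun T y > 0" for y
    unfolding tail_fun_def by (rule regularly_varying_tail_pos[OF L T mono])
  let ?f = "\<lambda>y x. tail_fun T (x * y) / tail_fun T y * binom_wt j (nat \<lfloor>x * y\<rfloor>) (1 / y)"
  have int: "set_integrable lborel {0<..} (?f y)" and E: "E y / tail_fun T y = (LINT x:{0<..}|lborel. ?f y x)"
    if "y \<ge> 1" for y
    using expectation_neg_binom_cdf[OF D that, of j]
    by (simp_all add: T_def E_def)
  show "((\<lambda>y. E y / tail_fun T y) \<longlongrightarrow> Gamma (real j + 1 - \<gamma>) / fact j) at_top"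
    if j: "\<gamma> < real j + 1"
  proof -
    \<comment> \<open>any exponent strictly between \<open>\<gamma>\<close> and \<open>j + 1\<close> keeps the majorant integrable\<close>
    define \<alpha> where "\<alpha> = (\<gamma> + (real j + 1)) / 2"
    have \<alpha>: "\<gamma> < \<alpha>" "\<alpha> < real j + 1" using j by (auto simp: \<alpha>_def)
    have "set_integrable lborel {0<..} (\<lambda>x. x powr (real j - \<alpha>) * exp (- x))"
      using Gamma_density_integral(1)[of "real j + 1 - \<alpha>"] \<alpha> by simp
    from tail_binom_integral_limit[OF L T mono \<gamma> \<alpha>(1) _ _ this]
    have "((\<lambda>y. LINT x:{0<..}|lborel. ?f y x) \<longlongrightarrow>
        (LINT x:{0<..}|lborel. x powr (real j - \<gamma>) * exp (- x) / fact j)) at_top"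
      by simp
    also have "(LINT x:{0<..}|lborel. x powr (real j - \<gamma>) * exp (- x) / fact j) =
        Gamma (real j + 1 - \<gamma>) / fact j"
      using Gamma_density_integral(2)[of "real j + 1 - \<gamma>"] j by simp
    finally show ?thesis
      by (rule Lim_transform_eventually)
        (rule eventually_mono[OF eventually_ge_at_top[of 1]], simp only: E)
  qed
  show "filterlim (\<lambda>y. E y / tail_fun T y) at_top at_top" if j: "\<gamma> = real j + 1"
    unfolding filterlim_at_top_dense
  proof
    fix K :: real
    \<comment> \<open>the solution of \<open>exp (- 1) / fact j * (- ln e) = \<bar>K\<bar> + 1\<close>\<close>
    define e where "e = exp (- ((\<bar>K\<bar> + 1) * exp 1 * fact j))"
    have e: "0 < e" "e \<le> 1" by (auto simp: e_def)
    let ?A = "{e..1}"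
    have int1: "set_integrable lborel ?A (\<lambda>x. x powr (real j - (\<gamma> + 1)) * exp (- x))"
      using e by (intro borel_integrable_atLeastAtMost' continuous_intros) auto
    have int2: "set_integrable lborel ?A (\<lambda>x. x powr (real j - \<gamma>) * exp (- x) / fact j)"
      using e by (intro borel_integrable_atLeastAtMost' continuous_intros) auto
    have int3: "set_integrable lborel ?A (\<lambda>x. exp (- 1) / fact j * (1 / x))"
      using e by (intro borel_integrable_atLeastAtMost' continuous_intros) auto
    have lim: "((\<lambda>y. LINT x:?A|lborel. ?f y x) \<longlongrightarrow>
        (LINT x:?A|lborel. x powr (real j - \<gamma>) * exp (- x) / fact j)) at_top"
      by (rule tail_binom_integral_limit[OF L T mono \<gamma> _ _ _ int1]) (use e in auto)
    have "(\<integral>x. (1 / x) * indicator ?A x \<partial>lborel) = ln 1 - ln e"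
      using e by (intro integral_FTC_Icc_real)
        (auto intro!: derivative_eq_intros continuous_intros simp: field_simps)
    then have "(LINT x:?A|lborel. 1 / x) = - ln e"
      by (simp add: set_lebesgue_integral_def mult.commute)
    then have "(LINT x:?A|lborel. exp (- 1) / fact j * (1 / x)) = exp (- 1) / fact j * (- ln e)"
      by (simp only: set_integral_mult_right)
    also have "\<dots> = \<bar>K\<bar> + 1"
      by (simp add: e_def exp_minus field_simps)
    finally have "\<bar>K\<bar> + 1 = (LINT x:?A|lborel. exp (- 1) / fact j * (1 / x))" ..
    also have "\<dots> \<le> (LINT x:?A|lborel. x powr (real j - \<gamma>) * exp (- x) / fact j)"
    proof (rule set_integral_mono[OF int3 int2])
      fix x assume x: "x \<in> ?A"
      have "exp (- 1) / fact j * (1 / x) \<le> exp (- x) / fact j * (1 / x)"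
        using x e by (intro mult_right_mono divide_right_mono) auto
      then show "exp (- 1) / fact j * (1 / x) \<le> x powr (real j - \<gamma>) * exp (- x) / fact j"
        using x e by (simp add: j powr_minus field_simps)
    qed
    finally have "K < (LINT x:?A|lborel. x powr (real j - \<gamma>) * exp (- x) / fact j)" by simp
    then have "\<forall>\<^sub>F y in at_top. K < (LINT x:?A|lborel. ?f y x)"
      by (rule order_tendstoD(1)[OF lim])
    then show "\<forall>\<^sub>F y in at_top. K < E y / tail_fun T y"
      using eventually_ge_at_top[of 1]
    proof eventually_elim
      case (elim y)
      have "set_integrable lborel ?A (?f y)"
        by (rule set_integrable_subset[OF int[OF elim(2)]]) (use e in auto)
      then have "(LINT x:?A|lborel. ?f y x) \<le> (LINT x:{0<..}|lborel. ?f y x)"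
        unfolding set_lebesgue_integral_def using int[OF elim(2)] unfolding set_integrable_def
      proof (rule integral_mono)
        fix x
        have "?f y x \<ge> 0"
          using pos elim(2) by (intro mult_nonneg_nonneg divide_nonneg_nonneg binom_wt_nonneg) (auto intro: less_imp_le)
        then show "indicat_real ?A x *\<^sub>R ?f y x \<le> indicat_real {0<..} x *\<^sub>R ?f y x"
          using e by (auto simp: indicator_def)
      qed
      then show ?case using elim(1) E[OF elim(2)] by linarith
    qed
  qed
qed

lemma thinning_pmf_eq_cdf_diff:
  assumes p: "0 \<le> p" "p \<le> 1" and D [measurable]: "D \<in> measurable M (count_space UNIV)"
    and S: "is_thinning M p D S"
  shows "prob {\<omega> \<in> space M. S \<omega> = Suc j} =
    expectation (\<lambda>\<omega>. neg_binom_cdf j (D \<omega>) p) - expectation (\<lambda>\<omega>. neg_binom_cdf (Suc j) (D \<omega>) p)"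
proof -
  have "integrable M (\<lambda>\<omega>. neg_binom_cdf i (D \<omega>) p)" for i
    by (rule integrable_const_bound[of _ 1]) (use neg_binom_cdf_bounds[OF p] in auto)
  then show ?thesis
    by (simp add: thinning_pmf[OF p D S] binom_wt_eq_cdf_diff)
qed

end

section \<open>Ratio of consecutive point probabilities\<close>

lemma Gamma_Suc_shift:
  fixes \<gamma> :: real
  assumes "\<gamma> < real j + 1"
  shows "Gamma (real (Suc j) + 1 - \<gamma>) = (real j + 1 - \<gamma>) * Gamma (real j + 1 - \<gamma>)"
proof -
  have "real j + 1 - \<gamma> \<notin> \<int>\<^sub>\<le>\<^sub>0"
    using assms nonpos_Ints_nonpos[of "real j + 1 - \<gamma>"] by force
  then have "Gamma (real j + 1 - \<gamma> + 1) = (real j + 1 - \<gamma>) * Gamma (real j + 1 - \<gamma>)"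
    by (rule Gamma_plus1)
  then show ?thesis by (simp add: algebra_simps)
qed

lemma Gamma_fact_difference:
  fixes \<gamma> :: real
  assumes "\<gamma> < real j + 1"
  shows "Gamma (real j + 1 - \<gamma>) / fact j - Gamma (real (Suc j) + 1 - \<gamma>) / fact (Suc j) =
    \<gamma> * Gamma (real j + 1 - \<gamma>) / fact (Suc j)"
proof -
  have "g / f - (c - \<gamma>) * g / (c * f) = \<gamma> * g / (c * f)" if "c > 0" "f > 0" for c f g :: real
    using that by (simp add: field_simps)
  from this[of "real j + 1" "fact j" "Gamma (real j + 1 - \<gamma>)"] show ?thesis
    unfolding Gamma_Suc_shift[OF assms] by (simp add: add.commute)
qed

theorem theorem2:
  fixes M :: "'a measure" and D :: "'a \<Rightarrow> nat" and S :: "real \<Rightarrow> 'a \<Rightarrow> nat"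
    and L :: "real \<Rightarrow> real" and \<beta> :: real and k :: nat
  assumes "prob_space M"
    and "D \<in> measurable M (count_space UNIV)"
    and "\<beta> > 1"
    and "slowly_varying L"
    and "(\<lambda>n::nat. \<P>(\<omega> in M. D \<omega> \<ge> n)) \<sim>[at_top] (\<lambda>n. L (real n) * real n powr (1 - \<beta>))"
    and "\<And>p. 0 < p \<Longrightarrow> p < 1 \<Longrightarrow> is_thinning M p D (S p)"
    and "real k \<ge> \<beta>"
  shows "((\<lambda>p. \<P>(\<omega> in M. S p \<omega> = k) / \<P>(\<omega> in M. S p \<omega> = k - 1))
            \<longlongrightarrow> (real k - \<beta>) / real k) (at_right 0)"
proof -
  interpret prob_space M by fact
  define \<gamma> where "\<gamma> = \<beta> - 1"
  have \<gamma>: "\<gamma> > 0" using assms(3) by (simp add: \<gamma>_def)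
  have "k \<ge> 2" using assms(3,7) by linarith
  then obtain l where l: "k = Suc (Suc l)"
    by (metis add_2_eq_Suc le_Suc_ex)
  have l\<gamma>: "\<gamma> \<le> real l + 1" using assms(7) by (simp add: l \<gamma>_def)
  let ?T = "\<lambda>n. prob {\<omega> \<in> space M. n \<le> D \<omega>}"
  let ?G = "tail_fun ?T"
  define E where "E j y = expectation (\<lambda>\<omega>. neg_binom_cdf j (D \<omega>) (1 / y))" for j y
  have T: "?T \<sim>[at_top] (\<lambda>n. L (real n) * real n powr (- \<gamma>))"
    using assms(5) by (simp add: \<gamma>_def)
  note asym = neg_binom_cdf_asymptotics[OF assms(2,4) T \<gamma>, folded E_def]
  have pos: "?G y > 0" for y
    unfolding tail_fun_def
    by (rule regularly_varying_tail_pos[OF assms(4) T])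
       (use assms(2) in \<open>auto intro!: antimonoI finite_measure_mono\<close>)
  have limit: "((\<lambda>y. (E j y - E (Suc j) y) / ?G y) \<longlongrightarrow> \<gamma> * Gamma (real j + 1 - \<gamma>) / fact (Suc j)) at_top"
    if "\<gamma> < real j + 1" for j
    using tendsto_diff[OF asym(1)[OF that] asym(1)[of "Suc j"]] that Gamma_fact_difference[OF that]
    by (simp add: diff_divide_distrib)
  have "((\<lambda>y. ((E (Suc l) y - E (Suc (Suc l)) y) / ?G y) / ((E l y - E (Suc l) y) / ?G y))
      \<longlongrightarrow> (real k - \<beta>) / real k) at_top"
  proof (cases "\<gamma> < real l + 1")
    case True
    have G: "Gamma (real l + 1 - \<gamma>) > 0" using True by (intro Gamma_real_pos) simp
    have "\<gamma> * Gamma (real (Suc l) + 1 - \<gamma>) / fact (Suc (Suc l)) / (\<gamma> * Gamma (real l + 1 - \<gamma>) / fact (Suc l))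
      = (real k - \<beta>) / real k"
      unfolding Gamma_Suc_shift[OF True] using G \<gamma> by (simp add: l \<gamma>_def divide_simps)
    moreover have nz: "\<gamma> * Gamma (real l + 1 - \<gamma>) / fact (Suc l) > 0"
      by (intro divide_pos_pos mult_pos_pos G \<gamma> fact_gt_zero)
    have "((\<lambda>y. ((E (Suc l) y - E (Suc (Suc l)) y) / ?G y) / ((E l y - E (Suc l) y) / ?G y)) \<longlongrightarrow>
      \<gamma> * Gamma (real (Suc l) + 1 - \<gamma>) / fact (Suc (Suc l)) / (\<gamma> * Gamma (real l + 1 - \<gamma>) / fact (Suc l))) at_top"
      by (rule tendsto_divide[OF limit limit[OF True] less_imp_neq[OF nz, symmetric]])
         (use True in simp)
    ultimately show ?thesis by simp
  next
    case False
    then have eq: "\<gamma> = real l + 1" using l\<gamma> by simp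
    have "filterlim (\<lambda>y. - (E (Suc l) y / ?G y) + E l y / ?G y) at_top at_top"
      using eq by (intro filterlim_tendsto_add_at_top[OF tendsto_minus[OF asym(1)]] asym(2)) auto
    then have "filterlim (\<lambda>y. (E l y - E (Suc l) y) / ?G y) at_infinity at_top"
      by (intro filterlim_at_top_imp_at_infinity) (simp add: diff_divide_distrib)
    then have "((\<lambda>y. ((E (Suc l) y - E (Suc (Suc l)) y) / ?G y) / ((E l y - E (Suc l) y) / ?G y)) \<longlongrightarrow> 0) at_top"
      using eq by (intro tendsto_divide_0[OF limit]) auto
    then show ?thesis using eq by (simp add: l \<gamma>_def)
  qed
  moreover have "\<forall>\<^sub>F y in at_top. ((E (Suc l) y - E (Suc (Suc l)) y) / ?G y) / ((E l y - E (Suc l) y) / ?G y) =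
      prob {\<omega> \<in> space M. S (inverse y) \<omega> = k} / prob {\<omega> \<in> space M. S (inverse y) \<omega> = k - 1}"
    using eventually_gt_at_top[of 1]
  proof eventually_elim
    case (elim y)
    have p: "0 < 1 / y" "1 / y < 1" using elim by auto
    have "prob {\<omega> \<in> space M. S (1 / y) \<omega> = Suc j} = E j y - E (Suc j) y" for j
      unfolding E_def using p by (intro thinning_pmf_eq_cdf_diff[OF _ _ assms(2) assms(6)]) auto
    then show ?case using pos[of y] by (simp add: l inverse_eq_divide)
  qed
  ultimately show ?thesis
    unfolding filterlim_at_right_to_top by (rule Lim_transform_eventually)
qed

end
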